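(* Let $H$ be a separable complex Hilbert space. Then the topological space $BFred(H)$ of B-Fredholm operators on $H$ is path connected.
   Context: $L(H)$ is the algebra of bounded linear operators on $H$; $N(T)$ and $R(T)$ are the nullspace and range of $T\in L(H)$. An operator $T\in L(H)$ is B-Fredholm if there exists an integer $n\geq 0$ such that $N(T)\cap R(T^n)$ is finite dimensional and $R(T)+N(T^n)$ has finite codimension in $H$. $BFred(H)$ is the set of B-Fredholm operators, with the topology induced by the operator norm of $L(H)$. *)

theory Defs
  imports "HOL-Analysis.Analysis"
begin

class complex_vector = real_vector +
  fixes scaleC :: "complex \<Rightarrow> 'a \<Rightarrow> 'a"  (infixr \<open>*\<^sub>C\<close> 75)
  assumes scaleC_add_right: "c *\<^sub>C (x + y) = c *\<^sub>C x + c *\<^sub>C y"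
    and scaleC_add_left: "(c + d) *\<^sub>C x = c *\<^sub>C x + d *\<^sub>C x"
    and scaleC_scaleC: "c *\<^sub>C d *\<^sub>C x = (c * d) *\<^sub>C x"
    and scaleC_one: "1 *\<^sub>C x = x"
    and scaleR_scaleC: "r *\<^sub>R x = complex_of_real r *\<^sub>C x"

global_interpretation complex_vector: vector_space "scaleC :: complex \<Rightarrow> 'a \<Rightarrow> 'a::complex_vector"
  by unfold_locales (simp_all add: scaleC_add_right scaleC_add_left scaleC_scaleC scaleC_one)

text \<open>The inner product is linear in the first argument. The norm, metric and topology are the
  ones of the underlying real normed space, and the last axiom ties them to the inner product.\<close>

class complex_inner = complex_vector + real_normed_vector +
  fixes cinner :: "'a \<Rightarrow> 'a \<Rightarrow> complex"
  assumes cinner_commute: "cinner x y = cnj (cinner y x)"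
    and cinner_add_left: "cinner (x + y) z = cinner x z + cinner y z"
    and cinner_scaleC_left: "cinner (c *\<^sub>C x) y = c * cinner x y"
    and cinner_self_nonneg: "0 \<le> Re (cinner x x)"
    and cinner_self_eq_0_iff: "cinner x x = 0 \<longleftrightarrow> x = 0"
    and norm_eq_sqrt_cinner: "norm x = sqrt (Re (cinner x x))"

class complex_hilbert_space = complex_inner + complete_space

text \<open>The library type of bounded linear maps contains all real-linear ones, so the members of
  \<open>L(H)\<close> are singled out by complex linearity. Its norm is the operator norm, which does not depend
  on the scalar field.\<close>

definition bounded_operators :: "('h::complex_hilbert_space \<Rightarrow>\<^sub>L 'h) set" where
  "bounded_operators = {T. Vector_Spaces.linear (*\<^sub>C) (*\<^sub>C) (blinfun_apply T)}"

definition nullspace :: "('h::complex_hilbert_space \<Rightarrow> 'h) \<Rightarrow> 'h set" where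
  "nullspace f = {x. f x = 0}"

definition finite_dimensional :: "'h::complex_vector set \<Rightarrow> bool" where
  "finite_dimensional S \<longleftrightarrow>
    complex_vector.subspace S \<and> (\<exists>B. finite B \<and> complex_vector.span B = S)"

text \<open>The quotient space by \<open>S\<close> is spanned by the cosets of the elements of a finite set \<open>B\<close>.
  The sum of two sets is the elementwise one.\<close>

definition finite_codimensional :: "'h::complex_vector set \<Rightarrow> bool" where
  "finite_codimensional S \<longleftrightarrow>
    complex_vector.subspace S \<and> (\<exists>B. finite B \<and> S + complex_vector.span B = UNIV)"

definition b_fredholm :: "('h::complex_hilbert_space \<Rightarrow>\<^sub>L 'h) \<Rightarrow> bool" where
  "b_fredholm T \<longleftrightarrow> (\<exists>n::nat.
    finite_dimensional (nullspace (blinfun_apply T) \<inter> range (blinfun_apply T ^^ n)) \<and>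
    finite_codimensional (range (blinfun_apply T) + nullspace (blinfun_apply T ^^ n)))"

definition BFred :: "('h::complex_hilbert_space \<Rightarrow>\<^sub>L 'h) set" where
  "BFred = {T \<in> bounded_operators. b_fredholm T}"

end

theory Submission
  imports Defs
begin

text \<open>The set of B-Fredholm operators is star-shaped about \<open>0\<close>: multiplication by a nonzero real
  number changes neither the null spaces nor the ranges of the powers of an operator, and the zero
  operator itself is B-Fredholm, with \<open>n = 1\<close>.\<close>

lemma funpow_scaleR_blinfun:
  fixes T :: "'a::real_normed_vector \<Rightarrow>\<^sub>L 'a"
  shows "(blinfun_apply (t *\<^sub>R T) ^^ n) x = t ^ n *\<^sub>R (blinfun_apply T ^^ n) x"
  by (induction n) (simp_all add: blinfun.scaleR_left blinfun.scaleR_right)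

lemma nullspace_funpow_scaleR_blinfun:
  fixes T :: "'h::complex_hilbert_space \<Rightarrow>\<^sub>L 'h"
  assumes "t \<noteq> 0"
  shows "nullspace (blinfun_apply (t *\<^sub>R T) ^^ n) = nullspace (blinfun_apply T ^^ n)"
  using assms by (simp add: nullspace_def funpow_scaleR_blinfun)

lemma funpow_blinfun_scaleR:
  fixes T :: "'a::real_normed_vector \<Rightarrow>\<^sub>L 'a"
  shows "(blinfun_apply T ^^ n) (c *\<^sub>R x) = c *\<^sub>R (blinfun_apply T ^^ n) x"
  by (induction n) (simp_all add: blinfun.scaleR_right)

text \<open>The factor \<open>t ^ n\<close> can be moved into the argument by linearity, and it is
  invertible, so each value of one power is also a value of the other.\<close>

lemma range_funpow_scaleR_blinfun:
  fixes T :: "'a::real_normed_vector \<Rightarrow>\<^sub>L 'a"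
  assumes "t \<noteq> 0"
  shows "range (blinfun_apply (t *\<^sub>R T) ^^ n) = range (blinfun_apply T ^^ n)"
proof -
  have "(blinfun_apply (t *\<^sub>R T) ^^ n) x = (blinfun_apply T ^^ n) (t ^ n *\<^sub>R x)" for x
    by (simp add: funpow_scaleR_blinfun funpow_blinfun_scaleR)
  moreover have "(blinfun_apply T ^^ n) x = (blinfun_apply (t *\<^sub>R T) ^^ n) (inverse (t ^ n) *\<^sub>R x)" for x
    using assms by (simp add: funpow_scaleR_blinfun funpow_blinfun_scaleR)
  ultimately show ?thesis
    by (metis (no_types, lifting) image_subsetI rangeI subset_antisym)
qed

lemma b_fredholm_scaleR:
  assumes "t \<noteq> 0" "b_fredholm T"
  shows "b_fredholm (t *\<^sub>R T)"
  \<comment> \<open>B-Fredholmness speaks of the operator itself as well as of its power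
    \<open>n\<close>; the instances with exponent \<open>1\<close> take care of the former.\<close>
  using assms(2) nullspace_funpow_scaleR_blinfun[OF assms(1), of 1 T]
    range_funpow_scaleR_blinfun[OF assms(1), of 1 T]
  by (simp add: b_fredholm_def nullspace_funpow_scaleR_blinfun[OF assms(1)]
      range_funpow_scaleR_blinfun[OF assms(1)])

lemma b_fredholm_0: "b_fredholm (0 :: 'h::complex_hilbert_space \<Rightarrow>\<^sub>L 'h)"
proof -
  have "finite_dimensional {0 :: 'h}"
    unfolding finite_dimensional_def
    by (metis complex_vector.span_empty complex_vector.subspace_0 complex_vector.subspace_span
        finite.emptyI)
  moreover have "finite_codimensional (UNIV :: 'h set)"
    unfolding finite_codimensional_def
    by (intro conjI exI[of _ "{}"]) (auto simp: set_plus_def)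
  moreover have "nullspace (blinfun_apply (0 :: 'h \<Rightarrow>\<^sub>L 'h)) = UNIV"
    "range (blinfun_apply (0 :: 'h \<Rightarrow>\<^sub>L 'h)) = {0}"
    by (auto simp: nullspace_def)
  \<comment> \<open>With exponent \<open>1\<close> the intersection is \<open>{0}\<close> and the
    sum is the whole space. Exponent \<open>0\<close> would fail in infinite dimension: the null
    space of the zero operator meets the range of the identity in the whole space.\<close>
  ultimately show ?thesis
    unfolding b_fredholm_def by (intro exI[of _ 1]) (simp add: set_plus_def)
qed

text \<open>Real scaling is complex scaling by \<open>complex_of_real t\<close>, which commutes with
  every complex scalar, so complex linearity survives.\<close>

lemma bounded_operators_scaleR:
  assumes "T \<in> bounded_operators"
  shows "t *\<^sub>R T \<in> bounded_operators"
  using assms unfolding bounded_operators_def mem_Collect_eq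
  by (simp add: Vector_Spaces.linear_iff complex_vector.vector_space_axioms blinfun.scaleR_left
      scaleR_scaleC scaleC_add_right scaleC_scaleC mult.commute)

lemma BFred_scaleR:
  assumes "T \<in> BFred"
  shows "t *\<^sub>R T \<in> BFred"
  using assms bounded_operators_scaleR[of T t] b_fredholm_scaleR[of t T] b_fredholm_0
  \<comment> \<open>Scaling by \<open>0\<close> can change null space and range, so this case rests
    on the zero operator being B-Fredholm.\<close>
  by (cases "t = 0") (auto simp: BFred_def)

theorem theorem4p3:
  assumes "separable_space (euclidean :: 'h::complex_hilbert_space topology)"
  shows "path_connected (BFred :: ('h \<Rightarrow>\<^sub>L 'h) set)"
proof -
  have "(0 :: 'h \<Rightarrow>\<^sub>L 'h) \<in> BFred"
    by (auto simp: BFred_def b_fredholm_0 bounded_operators_def Vector_Spaces.linear_iff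
        complex_vector.vector_space_axioms)
  \<comment> \<open>The points of the segment are the multiples \<open>u *\<^sub>R T\<close> with
    \<open>0 \<le> u\<close> and \<open>u \<le> 1\<close>.\<close>
  moreover have "closed_segment 0 T \<subseteq> BFred" if "T \<in> BFred" for T :: "'h \<Rightarrow>\<^sub>L 'h"
    using that by (auto simp: closed_segment_def BFred_scaleR)
  ultimately show ?thesis
    by (intro starlike_imp_path_connected) (auto simp: starlike_def)
qed

end
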